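(* Let $S$ be a numerical semigroup, let $I$ be a proper ideal of $S$, let $X$ be the minimal generating system of $S$, let $\langle X\mid R\rangle$ be a semigroup presentation of $S$, and let $G$ be the minimal ideal generating system of $I$. For each $g\in G$ let $w_g$ be a fixed word of $X^+$ representing the element $g$. Let $R'=R_1\cup R_2$, where $$R_1=\{(u,v)\mid (u,v)\in R \text{ and } u,v\in (X\setminus I)^+\},$$ $$R_2=\{(u,0)\mid (u,v)\in R \text{ or } (v,u)\in R, \text{ with } u\in (X\setminus I)^+ \text{ and } v\in X^+\setminus (X\setminus I)^+\}.$$ Then the Rees quotient $S/I$ is defined by the presentation with zero $$\langle X\setminus I\mid R',\ w_g=0\ (g\in G\setminus X)\rangle$$ over its minimal generating system $X\setminus I$.
   Context: A numerical semigroup is here a subsemigroup $S$ of the additive semigroup of positive integers with finite complement. It has a unique minimal generating system $X$, which is finite. $S^0$ denotes the monoid $S\cup\{0\}$. An ideal of $S$ is a nonempty subset $I\subseteq S$ with $I+S\subseteq I$; it is proper if $I\ne S$. An ideal generating system of $I$ is a set $G\subseteq I$ with $I=G+S^0$; there is a unique minimal one, and it is finite. The Rees quotient $S/I$ is obtained from $S$ by identifying all elements of $I$ to a single element, which is the zero of $S/I$; elements of $S\setminus I$ are identified with their (singleton) classes. The minimal generating system of $S/I$ is $X\setminus I$ (it is the minimum generating set of $S/I$ for inclusion). $X^+$ denotes the free semigroup on $X$; the elements of $X$ serve both as letters and as elements of $S$, and a word of $X^+$ represents the element of $S$ obtained by evaluating it in $S$. A presentation with zero $\langle A\mid \mathfrak{R}\rangle$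 defines the quotient of the free semigroup with zero $A^+_0$ (that is, $A^+$ with a zero $0$ adjoined) by the congruence generated by $\mathfrak{R}\subseteq A_0^+\times A_0^+$. Saying that $S/I$ is defined by a presentation with zero over $X\setminus I$ means that the natural homomorphism $(X\setminus I)^+_0\to S/I$ (sending each letter $x$ to its class and $0$ to the zero of $S/I$) is surjective with kernel equal to the congruence generated by the relations. *)

theory Defs
  imports Main
begin

text \<open>A semigroup is given by its carrier set \<open>M\<close> and its operation \<open>f\<close>; a numerical semigroup
  is a set of natural numbers with the operation \<open>(+)\<close>.\<close>

definition numerical_semigroup :: "nat set \<Rightarrow> bool" where
  "numerical_semigroup S \<longleftrightarrow>
     S \<subseteq> {0<..} \<and> (\<forall>a\<in>S. \<forall>b\<in>S. a + b \<in> S) \<and> finite ({0<..} - S)"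

definition semigroup_ideal :: "nat set \<Rightarrow> nat set \<Rightarrow> bool" where
  "semigroup_ideal S I \<longleftrightarrow> I \<noteq> {} \<and> I \<subseteq> S \<and> (\<forall>i\<in>I. \<forall>s\<in>S. i + s \<in> I)"

definition proper_ideal :: "nat set \<Rightarrow> nat set \<Rightarrow> bool" where
  "proper_ideal S I \<longleftrightarrow> semigroup_ideal S I \<and> I \<noteq> S"

definition ideal_generating_system :: "nat set \<Rightarrow> nat set \<Rightarrow> nat set \<Rightarrow> bool" where
  "ideal_generating_system S I G \<longleftrightarrow> G \<subseteq> I \<and> I = {g + s | g s. g \<in> G \<and> s \<in> S \<union> {0}}"

definition minimal_ideal_generating_system :: "nat set \<Rightarrow> nat set \<Rightarrow> nat set \<Rightarrow> bool" where
  "minimal_ideal_generating_system S I G \<longleftrightarrow>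
     ideal_generating_system S I G \<and> (\<forall>H. H \<subset> G \<longrightarrow> \<not> ideal_generating_system S I H)"

inductive_set subsemigroup_span :: "('a \<Rightarrow> 'a \<Rightarrow> 'a) \<Rightarrow> 'a set \<Rightarrow> 'a set"
  for f :: "'a \<Rightarrow> 'a \<Rightarrow> 'a" and A :: "'a set" where
  gen: "a \<in> A \<Longrightarrow> a \<in> subsemigroup_span f A"
| mult: "a \<in> subsemigroup_span f A \<Longrightarrow> b \<in> subsemigroup_span f A \<Longrightarrow> f a b \<in> subsemigroup_span f A"

definition generating_system :: "'a set \<Rightarrow> ('a \<Rightarrow> 'a \<Rightarrow> 'a) \<Rightarrow> 'a set \<Rightarrow> bool" where
  "generating_system M f A \<longleftrightarrow> A \<subseteq> M \<and> subsemigroup_span f A = M"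

definition minimal_generating_system :: "'a set \<Rightarrow> ('a \<Rightarrow> 'a \<Rightarrow> 'a) \<Rightarrow> 'a set \<Rightarrow> bool" where
  "minimal_generating_system M f A \<longleftrightarrow>
     generating_system M f A \<and> (\<forall>B. B \<subset> A \<longrightarrow> \<not> generating_system M f B)"

definition minimum_generating_system :: "'a set \<Rightarrow> ('a \<Rightarrow> 'a \<Rightarrow> 'a) \<Rightarrow> 'a set \<Rightarrow> bool" where
  "minimum_generating_system M f A \<longleftrightarrow>
     generating_system M f A \<and> (\<forall>B. generating_system M f B \<longrightarrow> A \<subseteq> B)"

definition congruence_on :: "'a set \<Rightarrow> ('a \<Rightarrow> 'a \<Rightarrow> 'a) \<Rightarrow> ('a \<times> 'a) set \<Rightarrow> bool" where
  "congruence_on M f \<rho> \<longleftrightarrow>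
     equiv M \<rho> \<and> (\<forall>(a, b)\<in>\<rho>. \<forall>(c, d)\<in>\<rho>. (f a c, f b d) \<in> \<rho>)"

text \<open>The family below is nonempty only if \<open>R \<subseteq> M \<times> M\<close>, which is demanded wherever this is used.\<close>

definition generated_congruence ::
  "'a set \<Rightarrow> ('a \<Rightarrow> 'a \<Rightarrow> 'a) \<Rightarrow> ('a \<times> 'a) set \<Rightarrow> ('a \<times> 'a) set" where
  "generated_congruence M f R = \<Inter>{\<rho>. congruence_on M f \<rho> \<and> R \<subseteq> \<rho>}"

definition free_semigroup :: "'a set \<Rightarrow> 'a list set" where
  "free_semigroup A = {w. w \<noteq> [] \<and> set w \<subseteq> A}"

text \<open>The free semigroup with zero: \<open>None\<close> is the adjoined zero.\<close>

definition free_semigroup0 :: "'a set \<Rightarrow> 'a list option set" where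
  "free_semigroup0 A = Some ` free_semigroup A \<union> {None}"

fun append0 :: "'a list option \<Rightarrow> 'a list option \<Rightarrow> 'a list option" where
  "append0 (Some u) (Some v) = Some (u @ v)"
| "append0 _ _ = None"

text \<open>The homomorphism from nonempty words extending the letter assignment \<open>\<phi>\<close>
  (unspecified on the empty word), and its extension sending the adjoined zero to \<open>z\<close>.\<close>

fun word_eval :: "('b \<Rightarrow> 'b \<Rightarrow> 'b) \<Rightarrow> ('a \<Rightarrow> 'b) \<Rightarrow> 'a list \<Rightarrow> 'b" where
  "word_eval f \<phi> [x] = \<phi> x"
| "word_eval f \<phi> (x # y # ys) = f (\<phi> x) (word_eval f \<phi> (y # ys))"

definition word_eval0 :: "('b \<Rightarrow> 'b \<Rightarrow> 'b) \<Rightarrow> 'b \<Rightarrow> ('a \<Rightarrow> 'b) \<Rightarrow> 'a list option \<Rightarrow> 'b" where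
  "word_eval0 f z \<phi> w = (case w of None \<Rightarrow> z | Some u \<Rightarrow> word_eval f \<phi> u)"

definition hom_kernel :: "'a set \<Rightarrow> ('a \<Rightarrow> 'b) \<Rightarrow> ('a \<times> 'a) set" where
  "hom_kernel C h = {(u, v). u \<in> C \<and> v \<in> C \<and> h u = h v}"

definition defined_by_presentation ::
  "'b set \<Rightarrow> ('b \<Rightarrow> 'b \<Rightarrow> 'b) \<Rightarrow> ('a \<Rightarrow> 'b) \<Rightarrow> 'a set \<Rightarrow> ('a list \<times> 'a list) set \<Rightarrow> bool" where
  "defined_by_presentation M f \<phi> A R \<longleftrightarrow>
     R \<subseteq> free_semigroup A \<times> free_semigroup A \<and>
     word_eval f \<phi> ` free_semigroup A = M \<and>
     hom_kernel (free_semigroup A) (word_eval f \<phi>) = generated_congruence (free_semigroup A) (@) R"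

definition defined_by_presentation0 ::
  "'b set \<Rightarrow> ('b \<Rightarrow> 'b \<Rightarrow> 'b) \<Rightarrow> 'b \<Rightarrow> ('a \<Rightarrow> 'b) \<Rightarrow> 'a set \<Rightarrow>
     ('a list option \<times> 'a list option) set \<Rightarrow> bool" where
  "defined_by_presentation0 M f z \<phi> A R \<longleftrightarrow>
     R \<subseteq> free_semigroup0 A \<times> free_semigroup0 A \<and>
     word_eval0 f z \<phi> ` free_semigroup0 A = M \<and>
     hom_kernel (free_semigroup0 A) (word_eval0 f z \<phi>) =
       generated_congruence (free_semigroup0 A) append0 R"

text \<open>The Rees quotient consists of the classes of the relation identifying all elements of \<open>I\<close>:
  the class \<open>I\<close>, which is its zero, and the singletons \<open>{s}\<close> with \<open>s \<in> S - I\<close>.\<close>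

definition rees_relation :: "nat set \<Rightarrow> nat set \<Rightarrow> (nat \<times> nat) set" where
  "rees_relation S I = Id_on S \<union> I \<times> I"

definition rees_quotient :: "nat set \<Rightarrow> nat set \<Rightarrow> nat set set" where
  "rees_quotient S I = S // rees_relation S I"

definition rees_class :: "nat set \<Rightarrow> nat set \<Rightarrow> nat \<Rightarrow> nat set" where
  "rees_class S I s = rees_relation S I `` {s}"

text \<open>The union is over the classes of all sums of representatives, which coincide.\<close>

definition rees_add :: "nat set \<Rightarrow> nat set \<Rightarrow> nat set \<Rightarrow> nat set \<Rightarrow> nat set" where
  "rees_add S I A B = (\<Union>a\<in>A. \<Union>b\<in>B. rees_class S I (a + b))"

end

theory Submission
  imports Defs
begin

text \<open>Let \<open>f\<close> send a word over \<open>X\<close> to itself if it avoids \<open>I\<close>, and to zero otherwise. It is a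
  homomorphism, so pulling back along \<open>f\<close> a congruence \<open>\<rho>\<close> that contains \<open>R'\<close> gives a congruence
  on \<open>X\<^sup>+\<close>. This one contains \<open>R\<close>, hence it identifies any two words with the same value in \<open>S\<close>.
  A word with value \<open>g + s\<close> in \<open>I\<close> is thus \<open>\<rho>\<close>-equivalent to the image under \<open>f\<close> of a word with
  prefix \<open>w\<^sub>g\<close> (or prefix \<open>g\<close>, if \<open>g\<close> is a letter), and so to zero.\<close>

section \<open>Congruences and homomorphisms\<close>

lemma generated_congruence_subset:
  "congruence_on M f \<rho> \<Longrightarrow> R \<subseteq> \<rho> \<Longrightarrow> generated_congruence M f R \<subseteq> \<rho>"
  unfolding generated_congruence_def by blast

lemma congruence_on_refl: "congruence_on M f \<rho> \<Longrightarrow> a \<in> M \<Longrightarrow> (a, a) \<in> \<rho>"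
  by (auto simp: congruence_on_def equiv_def dest: refl_onD)

lemma congruence_on_sym: "congruence_on M f \<rho> \<Longrightarrow> (a, b) \<in> \<rho> \<Longrightarrow> (b, a) \<in> \<rho>"
  by (auto simp: congruence_on_def equiv_def dest: symD)

lemma congruence_on_trans:
  "congruence_on M f \<rho> \<Longrightarrow> (a, b) \<in> \<rho> \<Longrightarrow> (b, c) \<in> \<rho> \<Longrightarrow> (a, c) \<in> \<rho>"
  by (auto simp: congruence_on_def equiv_def dest: transD)

lemma congruence_on_mult:
  "congruence_on M f \<rho> \<Longrightarrow> (a, b) \<in> \<rho> \<Longrightarrow> (c, d) \<in> \<rho> \<Longrightarrow> (f a c, f b d) \<in> \<rho>"
  unfolding congruence_on_def by blast

text \<open>Used twice: to see that kernels are congruences, and to pull a congruence on words with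
  zero back to words over \<open>X\<close>.\<close>

lemma congruence_on_hom_vimage:
  assumes \<rho>: "congruence_on N g \<rho>"
    and h: "\<And>a. a \<in> M \<Longrightarrow> h a \<in> N"
    and closed: "\<And>a b. a \<in> M \<Longrightarrow> b \<in> M \<Longrightarrow> f a b \<in> M"
    and hom: "\<And>a b. a \<in> M \<Longrightarrow> b \<in> M \<Longrightarrow> h (f a b) = g (h a) (h b)"
  shows "congruence_on M f {(a, b). a \<in> M \<and> b \<in> M \<and> (h a, h b) \<in> \<rho>}"
  unfolding congruence_on_def
proof
  show "equiv M {(a, b). a \<in> M \<and> b \<in> M \<and> (h a, h b) \<in> \<rho>}"
    by (intro equivI refl_onI symI transI)
      (auto intro: congruence_on_refl[OF \<rho>] congruence_on_sym[OF \<rho>] congruence_on_trans[OF \<rho>] h)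
qed (auto simp: closed hom intro: congruence_on_mult[OF \<rho>])

text \<open>Equality is a congruence on \<open>UNIV\<close> for every operation \<open>g\<close>,
  and the kernel is its pullback along \<open>h\<close>.\<close>

lemma congruence_on_hom_kernel:
  assumes "\<And>a b. a \<in> M \<Longrightarrow> b \<in> M \<Longrightarrow> f a b \<in> M"
    and "\<And>a b. a \<in> M \<Longrightarrow> b \<in> M \<Longrightarrow> h (f a b) = g (h a) (h b)"
  shows "congruence_on M f (hom_kernel M h)"
proof -
  have "congruence_on UNIV g Id"
    by (auto simp: congruence_on_def equiv_def refl_on_def sym_def trans_def)
  from congruence_on_hom_vimage[OF this, of M h f] assms show ?thesis
    by (simp add: hom_kernel_def)
qed

section \<open>Words and their values\<close>

lemma append0_free_semigroup0:
  "a \<in> free_semigroup0 A \<Longrightarrow> b \<in> free_semigroup0 A \<Longrightarrow> append0 a b \<in> free_semigroup0 A"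
  by (auto simp: free_semigroup0_def free_semigroup_def)

lemma append0_None_right [simp]: "append0 a None = None"
  by (cases a) auto

text \<open>Nonemptiness matters here: \<open>word_eval\<close> is unspecified on \<open>[]\<close>,
  while \<open>sum_list\<close> gives 0 there.\<close>

lemma word_eval_sum_list:
  "u \<noteq> [] \<Longrightarrow> word_eval (+) (\<lambda>x. x) u = (sum_list u :: 'a :: monoid_add)"
  by (induction u rule: induct_list012) auto

lemma hom_kernel_word_eval_iff:
  "(u, v) \<in> hom_kernel (free_semigroup A) (word_eval (+) (\<lambda>x. x)) \<longleftrightarrow>
     u \<in> free_semigroup A \<and> v \<in> free_semigroup A \<and> sum_list u = (sum_list v :: 'a :: monoid_add)"
  by (auto simp: hom_kernel_def free_semigroup_def word_eval_sum_list)

section \<open>Spans and irreducibility of minimal generators\<close>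

lemma subsemigroup_span_subset:
  assumes "A \<subseteq> M" and "\<And>a b. a \<in> M \<Longrightarrow> b \<in> M \<Longrightarrow> f a b \<in> M"
  shows "subsemigroup_span f A \<subseteq> M"
proof
  fix x assume "x \<in> subsemigroup_span f A"
  then show "x \<in> M" by induction (use assms in auto)
qed

lemma word_eval_in_subsemigroup_span:
  "u \<in> free_semigroup A \<Longrightarrow> word_eval f \<phi> u \<in> subsemigroup_span f (\<phi> ` A)"
  by (induction u rule: induct_list012)
    (auto simp: free_semigroup_def intro: subsemigroup_span.intros)

lemma subsemigroup_span_cases:
  assumes "x \<in> subsemigroup_span f A"
  obtains "x \<in> A" | a b where "a \<in> subsemigroup_span f A" "b \<in> subsemigroup_span f A" "x = f a b"
  using assms by cases auto

text \<open>If \<open>x = a + b\<close>, both summands are positive, hence smaller than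
  \<open>x\<close>, hence generated without \<open>x\<close>. Then \<open>X - {x}\<close> would
  already generate \<open>S\<close>.\<close>

lemma minimal_generating_system_irreducible:
  fixes S X :: "nat set"
  assumes pos: "S \<subseteq> {0<..}" and X: "minimal_generating_system S (+) X"
    and x: "x \<in> X" and a: "a \<in> S" and b: "b \<in> S"
  shows "x \<noteq> a + b"
proof
  assume x_eq: "x = a + b"
  have span: "X \<subseteq> S" "subsemigroup_span (+) X = S"
    using X by (auto simp: minimal_generating_system_def generating_system_def)
  \<comment> \<open>The summands of an element below \<open>x\<close> lie below \<open>x\<close>
    themselves, so \<open>x\<close> never occurs among the generators used.\<close>
  have below: "y \<in> subsemigroup_span (+) (X - {x})" if "y \<in> subsemigroup_span (+) X" "y < x" for y
    using that by induction (auto intro: subsemigroup_span.intros)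
  have "x \<in> subsemigroup_span (+) (X - {x})"
    unfolding x_eq using below[of a] below[of b] a b pos span
    by (intro subsemigroup_span.mult) (auto simp: x_eq)
  then have "subsemigroup_span (+) X \<subseteq> subsemigroup_span (+) (X - {x})"
    by (intro subsemigroup_span_subset) (auto intro: subsemigroup_span.intros)
  moreover have "subsemigroup_span (+) (X - {x}) \<subseteq> subsemigroup_span (+) X"
    by (intro subsemigroup_span_subset) (auto intro: subsemigroup_span.intros)
  ultimately have "generating_system S (+) (X - {x})"
    using span by (auto simp: generating_system_def)
  moreover have "X - {x} \<subset> X" using x by auto
  ultimately show False using X by (auto simp: minimal_generating_system_def)
qed

text \<open>Write \<open>i = g' + t\<close> with \<open>g'\<close> in \<open>G\<close>. Since
  \<open>s\<close> is positive, \<open>g'\<close> differs from \<open>g = g' + t + s\<close>, so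
  \<open>g'\<close> takes over everything that \<open>g\<close> generates, against minimality of
  \<open>G\<close>.\<close>

lemma minimal_ideal_generating_system_irreducible:
  assumes S: "numerical_semigroup S" and G: "minimal_ideal_generating_system S I G"
    and g: "g \<in> G" and i: "i \<in> I" and s: "s \<in> S"
  shows "g \<noteq> i + s"
proof
  assume g_eq: "g = i + s"
  let ?T = "\<lambda>H. {h + t | h t. h \<in> H \<and> t \<in> S \<union> {0}}"
  have I: "G \<subseteq> I" "I = ?T G"
    using G by (auto simp: minimal_ideal_generating_system_def ideal_generating_system_def)
  have add: "t + t' \<in> S \<union> {0}" if "t \<in> S \<union> {0}" "t' \<in> S \<union> {0}" for t t'
    using that S by (auto simp: numerical_semigroup_def)
  obtain g' t where g': "g' \<in> G" "t \<in> S \<union> {0}" "i = g' + t" using i I by blast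
  have "s > 0" using s S by (auto simp: numerical_semigroup_def)
  then have "g' \<noteq> g" using g_eq g' by simp
  then have g'': "g' \<in> G - {g}" using g' by simp
  have "j \<in> ?T (G - {g})" if j: "j \<in> I" for j
  proof -
    obtain h r where h: "h \<in> G" "r \<in> S \<union> {0}" "j = h + r" using j I by blast
    show ?thesis
    proof (cases "h = g")
      case True
      then have "j = g' + (t + s + r)" using h g_eq g' by simp
      moreover have "t + s + r \<in> S \<union> {0}" using add g' s h by blast
      ultimately show ?thesis using g'' by blast
    qed (use h in blast)
  qed
  moreover have "?T (G - {g}) \<subseteq> ?T G" by blast
  ultimately have "ideal_generating_system S I (G - {g})"
    using I unfolding ideal_generating_system_def by blast
  moreover have "G - {g} \<subset> G" using g by auto
  ultimately show False using G by (auto simp: minimal_ideal_generating_system_def)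
qed

section \<open>Words over the generators and membership in the ideal\<close>

locale numerical_semigroup_ideal =
  fixes S I X :: "nat set"
  assumes S: "numerical_semigroup S" and I: "proper_ideal S I"
    and X: "minimal_generating_system S (+) X"
begin

lemma pos: "a \<in> S \<Longrightarrow> a > 0"
  using S by (auto simp: numerical_semigroup_def)

lemma add_closed: "a \<in> S \<Longrightarrow> b \<in> S \<Longrightarrow> a + b \<in> S"
  using S by (auto simp: numerical_semigroup_def)

lemma ideal_subset: "I \<subseteq> S" and ideal_nonempty: "I \<noteq> {}" and ideal_proper: "I \<noteq> S"
  using I by (auto simp: proper_ideal_def semigroup_ideal_def)

lemma ideal_add: "i \<in> I \<Longrightarrow> s \<in> S \<union> {0} \<Longrightarrow> i + s \<in> I"
  and ideal_add': "i \<in> I \<Longrightarrow> s \<in> S \<union> {0} \<Longrightarrow> s + i \<in> I"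
  using I by (auto simp: proper_ideal_def semigroup_ideal_def add.commute)

lemma generators_subset: "X \<subseteq> S" and span_generators: "subsemigroup_span (+) X = S"
  using X by (auto simp: minimal_generating_system_def generating_system_def)

lemma sum_list_in: "set u \<subseteq> X \<Longrightarrow> sum_list u \<in> S \<union> {0}"
proof (induction u)
  case (Cons x u)
  then have "x \<in> S" "sum_list u \<in> S \<union> {0}" using generators_subset by auto
  then show ?case using add_closed[of x "sum_list u"] by (auto simp del: sum_list_eq_0_iff)
qed simp

lemma sum_list_free_in: "u \<in> free_semigroup X \<Longrightarrow> sum_list u \<in> S"
  using sum_list_in[of u] generators_subset pos
  by (cases u) (auto simp: free_semigroup_def)

text \<open>By commutativity the letter \<open>x\<close> can be split off; the remaining letters,
  possibly none, sum to an element of \<open>S \<union> {0}\<close>.\<close>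

lemma sum_list_in_ideal:
  assumes "set u \<subseteq> X" "x \<in> set u" "x \<in> I"
  shows "sum_list u \<in> I"
proof -
  have "sum_list (remove1 x u) \<in> S \<union> {0}"
    by (rule sum_list_in) (use assms set_remove1_subset in fast)
  then show ?thesis using assms ideal_add[of x]
    by (simp add: sum_list_map_remove1[of x u "\<lambda>x. x", simplified])
qed

lemma word_exists:
  assumes "s \<in> S" obtains u where "u \<in> free_semigroup X" "sum_list u = s"
proof -
  have "s \<in> subsemigroup_span (+) X" using assms span_generators by simp
  then have "\<exists>u. u \<in> free_semigroup X \<and> sum_list u = s"
  proof induction
    case (gen a)
    then show ?case by (intro exI[of _ "[a]"]) (auto simp: free_semigroup_def)
  next
    case (mult a b)
    then obtain u v where "u \<in> free_semigroup X" "sum_list u = a"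
      "v \<in> free_semigroup X" "sum_list v = b" by auto
    then show ?case by (intro exI[of _ "u @ v"]) (auto simp: free_semigroup_def)
  qed
  then show thesis using that by blast
qed

text \<open>Otherwise \<open>I\<close>, being closed under addition, would contain the whole span of
  \<open>X\<close>, which is \<open>S\<close>.\<close>

lemma generator_outside_ideal: obtains x where "x \<in> X - I"
proof -
  have "S \<subseteq> I" if "X \<subseteq> I"
    using that subsemigroup_span_subset[of X I "(+)"] span_generators ideal_add ideal_subset by auto
  then show thesis using that ideal_subset ideal_proper by blast
qed

section \<open>The Rees quotient and its minimum generating system\<close>

lemma rees_class_ideal [simp]: "s \<in> I \<Longrightarrow> rees_class S I s = I"
  using ideal_subset by (auto simp: rees_class_def rees_relation_def)

lemma rees_class_outside [simp]: "s \<in> S \<Longrightarrow> s \<notin> I \<Longrightarrow> rees_class S I s = {s}"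
  by (auto simp: rees_class_def rees_relation_def)

lemma rees_class_eq_ideal_iff: "s \<in> S \<Longrightarrow> rees_class S I s = I \<longleftrightarrow> s \<in> I"
  by (cases "s \<in> I") auto

lemma rees_class_eq_iff:
  "s \<in> S \<Longrightarrow> t \<in> S \<Longrightarrow> rees_class S I s = rees_class S I t \<longleftrightarrow> s = t \<or> s \<in> I \<and> t \<in> I"
  by (cases "s \<in> I"; cases "t \<in> I") auto

lemma rees_quotient_eq: "rees_quotient S I = rees_class S I ` S"
  by (auto simp: rees_quotient_def quotient_def rees_class_def)

lemma ideal_in_rees_quotient: "I \<in> rees_quotient S I"
proof -
  obtain i where "i \<in> I" using ideal_nonempty by blast
  then show ?thesis unfolding rees_quotient_eq using ideal_subset by (intro image_eqI[of _ _ i]) auto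
qed

text \<open>All sets in the union defining \<open>rees_add\<close> coincide: either both
  representatives are forced, or one of them runs through \<open>I\<close> and every sum lies in
  \<open>I\<close>.\<close>

lemma rees_add_class:
  assumes "s \<in> S" "t \<in> S"
  shows "rees_add S I (rees_class S I s) (rees_class S I t) = rees_class S I (s + t)"
proof -
  have "rees_class S I (a + b) = rees_class S I (s + t)"
    if "a \<in> rees_class S I s" "b \<in> rees_class S I t" for a b
    using that assms ideal_subset
    by (cases "s \<in> I"; cases "t \<in> I") (auto simp: ideal_add ideal_add' subsetD)
  moreover have "s \<in> rees_class S I s" "t \<in> rees_class S I t"
    using assms by (auto simp: rees_class_def rees_relation_def)
  ultimately show ?thesis unfolding rees_add_def by blast
qed

lemma rees_add_closed:
  "A \<in> rees_quotient S I \<Longrightarrow> B \<in> rees_quotient S I \<Longrightarrow> rees_add S I A B \<in> rees_quotient S I"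
  unfolding rees_quotient_eq using rees_add_class add_closed by auto

lemma rees_add_ideal:
  assumes "A \<in> rees_quotient S I"
  shows "rees_add S I I A = I" "rees_add S I A I = I"
proof -
  obtain s i where s: "s \<in> S" "A = rees_class S I s" and i: "i \<in> I"
    using assms ideal_nonempty by (auto simp: rees_quotient_eq)
  then have "i \<in> S" using ideal_subset by blast
  then show "rees_add S I I A = I" "rees_add S I A I = I"
    using rees_add_class[of i s] rees_add_class[of s i] s i by (simp_all add: ideal_add ideal_add')
qed

lemma word_eval_rees:
  "u \<in> free_semigroup X \<Longrightarrow>
     word_eval (rees_add S I) (rees_class S I) u = rees_class S I (sum_list u)"
proof (induction u rule: induct_list012)
  case (3 x y ys)
  then have "y # ys \<in> free_semigroup X" "x \<in> S"
    using generators_subset by (auto simp: free_semigroup_def)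
  then show ?case
    using 3 rees_add_class[of x "sum_list (y # ys)"] sum_list_free_in[of "y # ys"] by simp
qed (auto simp: free_semigroup_def)

text \<open>Since \<open>I\<close> is cofinite, a large multiple of any generator outside \<open>I\<close> lies in \<open>I\<close>; so the
  zero of the quotient is also a value of a word.\<close>

lemma rees_word_exists:
  assumes "s \<in> S"
  obtains u where "u \<in> free_semigroup (X - I)" "rees_class S I (sum_list u) = rees_class S I s"
proof (cases "s \<in> I")
  case False
  obtain u where u: "u \<in> free_semigroup X" "sum_list u = s" using word_exists assms by blast
  \<comment> \<open>A letter in \<open>I\<close> would force the value \<open>s\<close> into
    \<open>I\<close>.\<close>
  then have "u \<in> free_semigroup (X - I)"
    using False sum_list_in_ideal[of u] by (auto simp: free_semigroup_def)
  then show thesis using u that by simp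
next
  case True
  obtain x where x: "x \<in> X - I" by (rule generator_outside_ideal)
  have "finite ({0<..} - S)" using S by (simp add: numerical_semigroup_def)
  then obtain N where N: "\<And>m. m \<in> {0<..} - S \<Longrightarrow> m \<le> N"
    by (meson finite_nat_set_iff_bounded_le)
  \<comment> \<open>With \<open>N\<close> a bound on the gaps of \<open>S\<close> and
    \<open>x \<ge> 1\<close>, this makes \<open>?n * x - s\<close> exceed \<open>N\<close>. It thus
    lies in \<open>S\<close>, and adding it to \<open>s\<close> in \<open>I\<close> gives
    \<open>?n * x\<close> in \<open>I\<close>.\<close>
  let ?n = "s + N + 1"
  have "x > 0" using x generators_subset pos by auto
  then have "?n \<le> ?n * x" using mult_le_mono2[of 1 x ?n] by simp
  then have "?n * x - s > N" by simp
  then have "?n * x - s \<in> S" using N[of "?n * x - s"] by fastforce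
  then have "s + (?n * x - s) \<in> I" using True ideal_add by blast
  then have "?n * x \<in> I" using \<open>?n \<le> ?n * x\<close> by simp
  then have "rees_class S I (sum_list (replicate ?n x)) = rees_class S I s"
    using True by (simp only: sum_list_replicate of_nat_id rees_class_ideal)
  moreover have "replicate ?n x \<in> free_semigroup (X - I)"
    using x by (auto simp: free_semigroup_def)
  ultimately show thesis using that by blast
qed

lemma free_semigroup_outside_subset: "free_semigroup (X - I) \<subseteq> free_semigroup X"
  by (auto simp: free_semigroup_def)

lemma word_eval_rees_image:
  "word_eval (rees_add S I) (rees_class S I) ` free_semigroup (X - I) = rees_quotient S I"
proof
  show "word_eval (rees_add S I) (rees_class S I) ` free_semigroup (X - I) \<subseteq> rees_quotient S I"
    using free_semigroup_outside_subset
    by (auto simp: rees_quotient_eq subsetD word_eval_rees sum_list_free_in)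
next
  show "rees_quotient S I \<subseteq> word_eval (rees_add S I) (rees_class S I) ` free_semigroup (X - I)"
  proof
    fix A assume "A \<in> rees_quotient S I"
    then obtain s where "s \<in> S" "A = rees_class S I s" by (auto simp: rees_quotient_eq)
    then obtain u where u: "u \<in> free_semigroup (X - I)" "rees_class S I (sum_list u) = A"
      using rees_word_exists[of s] by metis
    then have "word_eval (rees_add S I) (rees_class S I) u = A"
      using free_semigroup_outside_subset by (auto simp: word_eval_rees subsetD)
    then show "A \<in> word_eval (rees_add S I) (rees_class S I) ` free_semigroup (X - I)"
      using u by blast
  qed
qed

text \<open>Generation follows from surjectivity of word evaluation. The class of a generator
  outside \<open>I\<close> is not a sum of two classes, because the generator is irreducible in
  \<open>S\<close>; so every generating system contains it.\<close>

lemma rees_minimum_generating_system: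
  "minimum_generating_system (rees_quotient S I) (rees_add S I) (rees_class S I ` (X - I))"
proof -
  let ?A = "rees_class S I ` (X - I)"
  have sub: "?A \<subseteq> rees_quotient S I" using generators_subset by (auto simp: rees_quotient_eq)
  then have "subsemigroup_span (rees_add S I) ?A \<subseteq> rees_quotient S I"
    by (rule subsemigroup_span_subset) (rule rees_add_closed)
  moreover have "rees_quotient S I \<subseteq> subsemigroup_span (rees_add S I) ?A"
    unfolding word_eval_rees_image[symmetric] using word_eval_in_subsemigroup_span by blast
  ultimately have "generating_system (rees_quotient S I) (rees_add S I) ?A"
    using sub by (simp add: generating_system_def)
  moreover have "?A \<subseteq> B" if B: "generating_system (rees_quotient S I) (rees_add S I) B" for B
  proof
    fix A assume "A \<in> ?A"
    then obtain x where x: "x \<in> X" "x \<notin> I" "x \<in> S" "A = rees_class S I x"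
      using generators_subset by auto
    have span: "subsemigroup_span (rees_add S I) B = rees_quotient S I"
      using B by (simp add: generating_system_def)
    then have "A \<in> subsemigroup_span (rees_add S I) B"
      unfolding span rees_quotient_eq using x by blast
    then show "A \<in> B"
    proof (cases rule: subsemigroup_span_cases)
      case (2 C D)
      then obtain c d where cd: "c \<in> S" "C = rees_class S I c" "d \<in> S" "D = rees_class S I d"
        unfolding span rees_quotient_eq by blast
      then have "rees_class S I x = rees_class S I (c + d)"
        using 2 x rees_add_class by simp
      \<comment> \<open>As \<open>x\<close> lies outside \<open>I\<close>, its class is a singleton,
        so equality of classes is equality in \<open>S\<close>.\<close>
      then have "x = c + d" using rees_class_eq_iff x cd add_closed by blast
      then show ?thesis
        using minimal_generating_system_irreducible[OF _ X] x cd S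
        by (metis numerical_semigroup_def)
    qed
  qed
  ultimately show ?thesis by (simp add: minimum_generating_system_def)
qed

lemma word_eval0_rees_None: "word_eval0 (rees_add S I) I (rees_class S I) None = I"
  by (simp add: word_eval0_def)

lemma word_eval0_rees_Some:
  "u \<in> free_semigroup (X - I) \<Longrightarrow>
     word_eval0 (rees_add S I) I (rees_class S I) (Some u) = rees_class S I (sum_list u)"
  using free_semigroup_outside_subset by (auto simp: word_eval0_def word_eval_rees subsetD)

lemma word_eval0_rees_image:
  "word_eval0 (rees_add S I) I (rees_class S I) ` free_semigroup0 (X - I) = rees_quotient S I"
  unfolding free_semigroup0_def image_Un image_image
  using word_eval_rees_image ideal_in_rees_quotient by (auto simp: word_eval0_def)

text \<open>The adjoined zero is matched by \<open>I\<close>, which absorbs every class under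
  \<open>rees_add\<close>; on genuine words the values simply add.\<close>

lemma word_eval0_rees_append0:
  assumes "a \<in> free_semigroup0 (X - I)" "b \<in> free_semigroup0 (X - I)"
  shows "word_eval0 (rees_add S I) I (rees_class S I) (append0 a b) =
    rees_add S I (word_eval0 (rees_add S I) I (rees_class S I) a)
      (word_eval0 (rees_add S I) I (rees_class S I) b)" (is "?h _ = rees_add S I (?h a) (?h b)")
proof (cases "a = None \<or> b = None")
  case True
  have "?h a \<in> rees_quotient S I" "?h b \<in> rees_quotient S I"
    using assms word_eval0_rees_image by blast+
  then show ?thesis using True by (auto simp: rees_add_ideal word_eval0_rees_None)
next
  case False
  then obtain u v where uv: "a = Some u" "b = Some v"
    "u \<in> free_semigroup (X - I)" "v \<in> free_semigroup (X - I)"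
    using assms by (auto simp: free_semigroup0_def)
  then have "u @ v \<in> free_semigroup (X - I)" by (auto simp: free_semigroup_def)
  moreover have "sum_list u \<in> S" "sum_list v \<in> S"
    using uv free_semigroup_outside_subset sum_list_free_in by blast+
  ultimately show ?thesis using uv by (simp add: word_eval0_rees_Some rees_add_class)
qed

text \<open>This is the map called \<open>f\<close> in the overview. It also sends \<open>[]\<close>
  to \<open>None\<close>, so it is multiplicative only on nonempty words.\<close>

definition kill_ideal :: "nat list \<Rightarrow> nat list option" where
  "kill_ideal u = (if u \<in> free_semigroup (X - I) then Some u else None)"

lemma kill_ideal_in: "kill_ideal u \<in> free_semigroup0 (X - I)"
  by (auto simp: kill_ideal_def free_semigroup0_def)

lemma kill_ideal_append:
  "u \<in> free_semigroup X \<Longrightarrow> v \<in> free_semigroup X \<Longrightarrow>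
     kill_ideal (u @ v) = append0 (kill_ideal u) (kill_ideal v)"
  by (auto simp: kill_ideal_def free_semigroup_def)

end

section \<open>The presentation with zero\<close>

theorem theorem4p6:
  fixes S I X G :: "nat set"
    and R :: "(nat list \<times> nat list) set"
    and w :: "nat \<Rightarrow> nat list"
    and R1 R2 W :: "(nat list option \<times> nat list option) set"
  assumes "numerical_semigroup S"
    and "proper_ideal S I"
    and "minimal_generating_system S (+) X"
    and "defined_by_presentation S (+) (\<lambda>x. x) X R"
    and "minimal_ideal_generating_system S I G"
    and "\<And>g. g \<in> G \<Longrightarrow> w g \<in> free_semigroup X \<and> word_eval (+) (\<lambda>x. x) (w g) = g"
    and R1_def: "R1 = {(Some u, Some v) | u v. (u, v) \<in> R \<and>
           u \<in> free_semigroup (X - I) \<and> v \<in> free_semigroup (X - I)}"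
    and R2_def: "R2 = {(Some u, None) | u v. ((u, v) \<in> R \<or> (v, u) \<in> R) \<and>
           u \<in> free_semigroup (X - I) \<and> v \<in> free_semigroup X - free_semigroup (X - I)}"
    and W_def: "W = {(Some (w g), None) | g. g \<in> G - X}"
  shows "minimum_generating_system (rees_quotient S I) (rees_add S I) (rees_class S I ` (X - I)) \<and>
         defined_by_presentation0 (rees_quotient S I) (rees_add S I) I (rees_class S I) (X - I)
           (R1 \<union> R2 \<union> W)"
proof -
  interpret numerical_semigroup_ideal S I X by unfold_locales (fact assms(1-3))+
  let ?h = "word_eval0 (rees_add S I) I (rees_class S I)"
  let ?F = "free_semigroup0 (X - I)"
  let ?R = "R1 \<union> R2 \<union> W"
  have R: "R \<subseteq> free_semigroup X \<times> free_semigroup X"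
    and kernel: "hom_kernel (free_semigroup X) (word_eval (+) (\<lambda>x. x)) =
      generated_congruence (free_semigroup X) (@) R"
    using assms(4) by (auto simp: defined_by_presentation_def)
  have G: "G \<subseteq> I" "I = {g + s | g s. g \<in> G \<and> s \<in> S \<union> {0}}"
    using assms(5) by (auto simp: minimal_ideal_generating_system_def ideal_generating_system_def)
  have w: "w g \<in> free_semigroup X" "sum_list (w g) = g" if "g \<in> G" for g
    using assms(6)[OF that] word_eval_sum_list[of "w g"] by (auto simp: free_semigroup_def)
  \<comment> \<open>\<open>R\<close> lies in the congruence it generates, which is the kernel of
    evaluation in \<open>S\<close>.\<close>
  have R_sum: "sum_list u = sum_list v" if "(u, v) \<in> R" for u v
  proof -
    have "R \<subseteq> generated_congruence (free_semigroup X) (@) R"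
      by (auto simp: generated_congruence_def)
    then show ?thesis using that kernel hom_kernel_word_eval_iff[of u v X] by auto
  qed

  \<comment> \<open>A letter \<open>x\<close> of \<open>w g\<close> in \<open>I\<close> would give
    \<open>g = x + s\<close>. Here \<open>s = 0\<close> is excluded by \<open>g \<notin> X\<close>,
    and \<open>s \<in> S\<close> by irreducibility of \<open>g\<close> in the ideal.\<close>
  have w_outside: "w g \<in> free_semigroup (X - I)" if g: "g \<in> G - X" for g
  proof (rule ccontr)
    assume "w g \<notin> free_semigroup (X - I)"
    then obtain x where x: "x \<in> set (w g)" "x \<in> I"
      using w g by (auto simp: free_semigroup_def)
    have "set (w g) \<subseteq> X" using w g by (auto simp: free_semigroup_def)
    then have "x \<in> X" "set (remove1 x (w g)) \<subseteq> X"
      using x set_remove1_subset[of x "w g"] by auto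
    moreover obtain s where s: "s = sum_list (remove1 x (w g))" by blast
    ultimately have "s \<in> S \<union> {0}" using sum_list_in[of "remove1 x (w g)"] by simp
    moreover have "g = x + s"
      using w g x s sum_list_map_remove1[of x "w g" "\<lambda>x. x"] by simp
    ultimately show False
      using minimal_ideal_generating_system_irreducible[OF assms(1,5)] g x \<open>x \<in> X\<close> by auto
  qed

  have rel: "?R \<subseteq> ?F \<times> ?F"
    using w_outside by (auto simp: R1_def R2_def W_def free_semigroup0_def)

  \<comment> \<open>Soundness: every relation holds in the Rees quotient.\<close>
  have "?R \<subseteq> hom_kernel ?F ?h"
  proof -
    have outside: "sum_list u \<in> S" if "u \<in> free_semigroup (X - I)" for u
      using that free_semigroup_outside_subset sum_list_free_in by blast
    have "(a, b) \<in> hom_kernel ?F ?h" if "(a, b) \<in> R1" for a b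
      using that rel R_sum by (auto simp: R1_def hom_kernel_def free_semigroup0_def word_eval0_rees_Some)
    moreover have "(a, b) \<in> hom_kernel ?F ?h" if ab: "(a, b) \<in> R2" for a b
    proof -
      obtain u v where uv: "a = Some u" "b = None" "(u, v) \<in> R \<or> (v, u) \<in> R"
        "u \<in> free_semigroup (X - I)" "v \<in> free_semigroup X - free_semigroup (X - I)"
        using ab by (auto simp: R2_def)
      \<comment> \<open>The word \<open>v\<close> over \<open>X\<close> is not over
        \<open>X - I\<close>, so it has a letter in \<open>I\<close>.\<close>
      then have "sum_list v \<in> I" using sum_list_in_ideal[of v] by (auto simp: free_semigroup_def)
      then have "sum_list u \<in> I" using R_sum uv by metis
      then show ?thesis using uv
        by (simp add: hom_kernel_def free_semigroup0_def word_eval0_rees_Some word_eval0_rees_None)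
    qed
    moreover have "(a, b) \<in> hom_kernel ?F ?h" if ab: "(a, b) \<in> W" for a b
    proof -
      obtain g where "g \<in> G - X" "a = Some (w g)" "b = None" using ab by (auto simp: W_def)
      moreover have "g \<in> I" using calculation G by auto
      ultimately show ?thesis using w w_outside
        by (simp add: hom_kernel_def free_semigroup0_def word_eval0_rees_Some word_eval0_rees_None)
    qed
    ultimately show ?thesis by auto
  qed
  moreover have "congruence_on ?F append0 (hom_kernel ?F ?h)"
    by (rule congruence_on_hom_kernel) (simp_all add: append0_free_semigroup0 word_eval0_rees_append0)
  ultimately have sub: "generated_congruence ?F append0 ?R \<subseteq> hom_kernel ?F ?h"
    by (intro generated_congruence_subset)

  \<comment> \<open>Completeness: the generated congruence is an intersection, so the kernel is
    compared with each member \<rho> of the family.\<close>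
  have "hom_kernel ?F ?h \<subseteq> \<rho>" if \<rho>: "congruence_on ?F append0 \<rho>" and R_\<rho>: "?R \<subseteq> \<rho>" for \<rho>
  proof -
    note refl = congruence_on_refl[OF \<rho>] and sym = congruence_on_sym[OF \<rho>]
      and trans = congruence_on_trans[OF \<rho>] and mult = congruence_on_mult[OF \<rho>]
    let ?\<sigma> = "{(u, v). u \<in> free_semigroup X \<and> v \<in> free_semigroup X \<and>
      (kill_ideal u, kill_ideal v) \<in> \<rho>}"
    have None_refl: "(None, None) \<in> \<rho>" using refl by (simp add: free_semigroup0_def)
    have "congruence_on (free_semigroup X) (@) ?\<sigma>"
      by (rule congruence_on_hom_vimage[OF \<rho>])
        (auto simp: kill_ideal_in kill_ideal_append free_semigroup_def)
    moreover have "R \<subseteq> ?\<sigma>"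
    proof clarify
      fix u v assume uv: "(u, v) \<in> R"
      then have mem: "u \<in> free_semigroup X" "v \<in> free_semigroup X" using R by auto
      \<comment> \<open>\<open>R1\<close> settles the first case and \<open>R2\<close> the two mixed
        ones; in the last case both words are sent to zero.\<close>
      consider "u \<in> free_semigroup (X - I)" "v \<in> free_semigroup (X - I)"
        | "u \<in> free_semigroup (X - I)" "v \<notin> free_semigroup (X - I)"
        | "u \<notin> free_semigroup (X - I)" "v \<in> free_semigroup (X - I)"
        | "u \<notin> free_semigroup (X - I)" "v \<notin> free_semigroup (X - I)" by blast
      then have "(kill_ideal u, kill_ideal v) \<in> \<rho>"
      proof cases
        case 1
        then have "(Some u, Some v) \<in> R1" using uv by (auto simp: R1_def)
        then show ?thesis using 1 R_\<rho> by (auto simp: kill_ideal_def)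
      next
        case 2
        then have "(Some u, None) \<in> R2" using uv mem by (auto simp: R2_def)
        then show ?thesis using 2 R_\<rho> by (auto simp: kill_ideal_def)
      next
        case 3
        then have "(Some v, None) \<in> R2" using uv mem by (auto simp: R2_def)
        then show ?thesis using 3 R_\<rho> sym by (auto simp: kill_ideal_def)
      qed (simp add: kill_ideal_def None_refl)
      then show "u \<in> free_semigroup X \<and> v \<in> free_semigroup X \<and>
        (kill_ideal u, kill_ideal v) \<in> \<rho>" using mem by simp
    qed
    ultimately have "hom_kernel (free_semigroup X) (word_eval (+) (\<lambda>x. x)) \<subseteq> ?\<sigma>"
      unfolding kernel by (rule generated_congruence_subset)
    then have same: "(kill_ideal u, kill_ideal v) \<in> \<rho>"
      if "u \<in> free_semigroup X" "v \<in> free_semigroup X" "sum_list u = sum_list v" for u v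
      using that hom_kernel_word_eval_iff[of u v X] by auto

    have zero: "(Some u, None) \<in> \<rho>" if u: "u \<in> free_semigroup (X - I)" "sum_list u \<in> I" for u
    proof -
      obtain g s where gs: "g \<in> G" "s \<in> S \<union> {0}" "sum_list u = g + s"
        using u G by blast
      \<comment> \<open>The prefix \<open>p\<close> is \<open>[g]\<close> if \<open>g\<close> is a
        letter, which is killed outright since \<open>g\<close> lies in \<open>I\<close>; otherwise
        it is \<open>w g\<close>, which \<open>W\<close> relates to zero.\<close>
      obtain p where p: "p \<in> free_semigroup X" "sum_list p = g" "(kill_ideal p, None) \<in> \<rho>"
      proof (cases "g \<in> X")
        case True
        have "g \<in> I" using gs G by blast
        then have "kill_ideal [g] = None" by (simp add: kill_ideal_def free_semigroup_def)
        then show ?thesis using True that[of "[g]"] None_refl by (simp add: free_semigroup_def)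
      next
        case False
        then have "(Some (w g), None) \<in> W" "kill_ideal (w g) = Some (w g)"
          using gs w_outside by (auto simp: W_def kill_ideal_def)
        then show ?thesis using that[of "w g"] w gs R_\<rho> by auto
      qed
      have "\<exists>q. q \<in> free_semigroup X \<and> sum_list q = g + s \<and> (kill_ideal q, None) \<in> \<rho>"
      \<comment> \<open>The value 0 has no word in the free semigroup, so in that case
        \<open>p\<close> itself serves as \<open>q\<close>.\<close>
      proof (cases "s = 0")
        case False
        then obtain t where t: "t \<in> free_semigroup X" "sum_list t = s" using gs word_exists by blast
        then have "(kill_ideal (p @ t), None) \<in> \<rho>"
          using mult[OF p(3) refl[OF kill_ideal_in[of t]]] p by (simp add: kill_ideal_append)
        then show ?thesis using p t by (intro exI[of _ "p @ t"]) (auto simp: free_semigroup_def)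
      qed (use p in auto)
      then obtain q where q: "q \<in> free_semigroup X" "sum_list q = g + s" "(kill_ideal q, None) \<in> \<rho>"
        by blast
      have "(kill_ideal u, kill_ideal q) \<in> \<rho>"
        using same u q gs free_semigroup_outside_subset by auto
      then show ?thesis using trans q(3) u by (auto simp: kill_ideal_def)
    qed

    show ?thesis
    proof clarify
      fix a b assume "(a, b) \<in> hom_kernel ?F ?h"
      then have ab: "a \<in> ?F" "b \<in> ?F" "?h a = ?h b" by (auto simp: hom_kernel_def)
      have to_zero: "(c, None) \<in> \<rho>" if "c \<in> ?F" "?h c = I" for c
      proof (cases c)
        case (Some u)
        then have u: "u \<in> free_semigroup (X - I)" using that by (auto simp: free_semigroup0_def)
        then have "sum_list u \<in> S" using free_semigroup_outside_subset sum_list_free_in by blast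
        then show ?thesis using that u Some zero
          by (simp add: word_eval0_rees_Some rees_class_eq_ideal_iff)
      qed (simp add: None_refl)
      show "(a, b) \<in> \<rho>"
      proof (cases "?h a = I")
        case True
        then show ?thesis using ab to_zero sym trans by metis
      \<comment> \<open>Away from zero the classes are singletons, so both words have the same value
        in \<open>S\<close>; \<open>kill_ideal\<close> fixes them, and \<open>same\<close> relates
        them.\<close>
      next
        case False
        then obtain u v where uv: "a = Some u" "b = Some v"
          "u \<in> free_semigroup (X - I)" "v \<in> free_semigroup (X - I)"
          using ab by (auto simp: free_semigroup0_def word_eval0_rees_None)
        moreover have S: "sum_list u \<in> S" "sum_list v \<in> S" "u \<in> free_semigroup X" "v \<in> free_semigroup X"
          using uv free_semigroup_outside_subset sum_list_free_in by blast+
        ultimately have "sum_list u = sum_list v"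
          using ab False by (auto simp: word_eval0_rees_Some rees_class_eq_iff)
        then show ?thesis using same[of u v] uv S by (simp add: kill_ideal_def)
      qed
    qed
  qed
  then have "hom_kernel ?F ?h \<subseteq> generated_congruence ?F append0 ?R"
    unfolding generated_congruence_def by blast
  then have "defined_by_presentation0 (rees_quotient S I) (rees_add S I) I (rees_class S I) (X - I) ?R"
    unfolding defined_by_presentation0_def using rel sub word_eval0_rees_image by blast
  then show ?thesis using rees_minimum_generating_system by simp
qed

end
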